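(* Let $p \ge 1$ be an integer, let $d \ge 0$, and let $v \in \mathbb{R}^p$ be nonzero. Let $\phi_d : \mathbb{R}^p \to \mathbb{R}$, $\phi_d(u) = (\|u\| - d)^2$, and define $\Phi_d(\cdot \mid v) : \mathbb{R}^p \to \mathbb{R}$ by $$\Phi_d(u \mid v) = \max\left\{ g_d(u),\; h_d\left( \frac{v^\top u}{\|v\|} - d \right) \right\},$$ where $g_d(u) = \left( \max\{0, \|u\| - d\} \right)^2$ and $h_d$ is the Huber function of parameter $d$. Then: (i) $\Phi_d(\cdot \mid v)$ is convex; (ii) $\Phi_d(\cdot \mid v)$ is tight at $v$, i.e. $\phi_d(v) = \Phi_d(v \mid v)$; (iii) $\Phi_d(\cdot \mid v)$ majorizes $\phi_d$, i.e. $\phi_d(u) \le \Phi_d(u \mid v)$ for all $u \in \mathbb{R}^p$.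
   Context: $\|\cdot\|$ is the Euclidean norm on $\mathbb{R}^p$. For a parameter $R \ge 0$, the Huber function $h_R : \mathbb{R} \to \mathbb{R}$ is $$h_R(r) = \begin{cases} 2R|r| - R^2 & \text{if } |r| \ge R, \\ r^2 & \text{if } |r| < R. \end{cases}$$ *)

theory Defs
  imports "HOL-Analysis.Analysis"
begin

definition huber :: "real \<Rightarrow> real \<Rightarrow> real" where
  "huber R r = (if \<bar>r\<bar> \<ge> R then 2 * R * \<bar>r\<bar> - R\<^sup>2 else r\<^sup>2)"

definition phi :: "real \<Rightarrow> real ^ 'p \<Rightarrow> real" where
  "phi d u = (norm u - d)\<^sup>2"

definition g :: "real \<Rightarrow> real ^ 'p \<Rightarrow> real" where
  "g d u = (max 0 (norm u - d))\<^sup>2"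

text \<open>The argument order is \<open>Phi d v u\<close> for the value at \<open>u\<close> of the majorizer
  with reference point \<open>v\<close>, so that \<open>Phi d v\<close> is the function of \<open>u\<close>.\<close>

definition Phi :: "real \<Rightarrow> real ^ 'p \<Rightarrow> real ^ 'p \<Rightarrow> real" where
  "Phi d v u = max (g d u) (huber d (inner v u / norm v - d))"

end

theory Submission
  imports Defs
begin

text \<open>Both pieces of the majorizer are suprema of convex functions: the inequality
  \<open>2 * s * r - s\<^sup>2 \<le> r\<^sup>2\<close> with equality at \<open>s = r\<close> gives
  \<open>huber d r = sup {2 * s * r - s\<^sup>2 | \<bar>s\<bar> \<le> d}\<close>, and restricting to \<open>s \<ge> 0\<close> instead
  gives \<open>(max 0 r)\<^sup>2\<close>. With \<open>r\<close> affine in \<open>u\<close> in the first case and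
  \<open>r = norm u - d\<close> in the second, every member of either family is convex in \<open>u\<close>.
  Majorization follows from Cauchy-Schwarz and the monotonicity of the Huber function
  in \<open>\<bar>r\<bar>\<close>.\<close>

text \<open>At a convex combination the minorant touching there equals \<open>f\<close>, and its own
  convexity bounds it by its values at the end points, which lie below \<open>f\<close>. No supremum
  has to be formed.\<close>

lemma convex_on_touching_minorants:
  fixes f :: "'a::real_vector \<Rightarrow> real"
  assumes S: "convex S"
    and minorant: "\<And>z. z \<in> S \<Longrightarrow> \<exists>k. convex_on S k \<and> k z = f z \<and> (\<forall>x\<in>S. k x \<le> f x)"
  shows "convex_on S f"
proof (rule convex_onI)
  fix t x y assume t: "0 < t" "t < (1::real)" and xy: "x \<in> S" "y \<in> S"
  let ?z = "(1 - t) *\<^sub>R x + t *\<^sub>R y"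
  have "?z \<in> S" using S t xy by (intro convexD) auto
  then obtain k where k: "convex_on S k" "k ?z = f ?z" "\<forall>x\<in>S. k x \<le> f x"
    using minorant by blast
  have "f ?z \<le> (1 - t) * k x + t * k y"
    using convex_onD[OF k(1), of t x y] k(2) t xy by simp
  also have "\<dots> \<le> (1 - t) * f x + t * f y"
    using k(3) t xy by (intro add_mono mult_left_mono) auto
  finally show "f ?z \<le> (1 - t) * f x + t * f y" .
qed (use S in simp)

lemma tangent_le_square: "2 * s * r - s\<^sup>2 \<le> (r::real)\<^sup>2"
  using zero_le_power2[of "r - s"] by (simp add: power2_diff algebra_simps)

lemma tangent_le_huber:
  assumes "\<bar>s\<bar> \<le> R"
  shows "2 * s * r - s\<^sup>2 \<le> huber R r"
proof (cases "R \<le> \<bar>r\<bar>")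
  case True
  have "s * r \<le> \<bar>s\<bar> * \<bar>r\<bar>"
    by (metis abs_ge_self abs_mult)
  \<comment> \<open>This product is the gap between \<open>2 * R * \<bar>r\<bar> - R\<^sup>2\<close>
    and the same expression with \<open>\<bar>s\<bar>\<close> for \<open>R\<close>; it is
    nonnegative since \<open>\<bar>s\<bar> \<le> R \<le> \<bar>r\<bar>\<close>.\<close>
  moreover have "0 \<le> (R - \<bar>s\<bar>) * (2 * \<bar>r\<bar> - R - \<bar>s\<bar>)"
    using assms True by (intro mult_nonneg_nonneg) auto
  moreover have "(R - \<bar>s\<bar>) * (2 * \<bar>r\<bar> - R - \<bar>s\<bar>) = 2 * R * \<bar>r\<bar> - R\<^sup>2 - 2 * (\<bar>s\<bar> * \<bar>r\<bar>) + s\<^sup>2"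
    by (simp add: algebra_simps power2_eq_square)
  ultimately show ?thesis
    using True by (simp add: huber_def)
qed (simp add: huber_def tangent_le_square)

lemma huber_eq_tangent:
  assumes "0 \<le> R"
  obtains s where "\<bar>s\<bar> \<le> R" "huber R r = 2 * s * r - s\<^sup>2"
proof (cases "R \<le> \<bar>r\<bar>")
  case True
  \<comment> \<open>Each linear branch is the tangent of the square at \<open>R\<close> or
    \<open>- R\<close>.\<close>
  show ?thesis
    using assms True by (intro that[of "if r < 0 then - R else R"]) (auto simp: huber_def)
next
  case False
  then show ?thesis
    by (intro that[of r]) (auto simp: huber_def power2_eq_square)
qed

lemma huber_eq_square: "\<bar>r\<bar> \<le> R \<Longrightarrow> huber R r = r\<^sup>2"
  by (auto simp: huber_def power2_eq_square)

lemma huber_le_square: "huber R r \<le> r\<^sup>2"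
  using tangent_le_square[of R "\<bar>r\<bar>"] by (simp add: huber_def)

lemma huber_mono:
  assumes "\<bar>r\<bar> \<le> R" "\<bar>r\<bar> \<le> \<bar>s\<bar>"
  shows "huber R r \<le> huber R s"
proof (cases "R \<le> \<bar>s\<bar>")
  case True
  have "r\<^sup>2 \<le> R\<^sup>2" using power_mono[OF assms(1), of 2] by simp
  also have "R\<^sup>2 \<le> 2 * R * \<bar>s\<bar> - R\<^sup>2"
    using mult_left_mono[OF True, of R] assms(1) by (simp add: power2_eq_square)
  finally show ?thesis
    using True assms(1) by (simp add: huber_eq_square) (simp add: huber_def)
next
  case False
  then show ?thesis
    using assms by (simp add: huber_eq_square flip: abs_le_square_iff)
qed

lemma abs_inner_div_norm_le: "\<bar>inner v u / norm v\<bar> \<le> norm u"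
  using Cauchy_Schwarz_ineq2[of v u]
  by (cases "v = 0") (simp_all add: divide_simps mult.commute)

lemma convex_on_g: "convex_on UNIV (g d)"
proof (rule convex_on_touching_minorants)
  fix z :: "real ^ 'p"
  \<comment> \<open>With this \<open>s\<close> the tangent touches at \<open>z\<close>;
    \<open>s \<ge> 0\<close> keeps the multiple of the norm convex.\<close>
  define s where "s = max 0 (norm z - d)"
  define k where "k = (\<lambda>u :: real ^ 'p. s * 2 * norm u + (- 2 * s * d - s\<^sup>2))"
  have "s \<ge> 0" by (simp add: s_def)
  then have "convex_on UNIV (\<lambda>u :: real ^ 'p. s * 2 * norm u)"
    using convex_on_dist[of UNIV "0 :: real ^ 'p"]
    by (intro convex_on_cmul) (auto simp: dist_norm)
  then have "convex_on UNIV k"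
    unfolding k_def by (intro convex_on_add) (simp_all only: convex_on_const convex_UNIV)
  moreover have "k z = g d z"
    by (auto simp: k_def s_def g_def max_def power2_eq_square algebra_simps)
  moreover have "k x \<le> g d x" for x
  proof -
    have "s * (norm x - d) \<le> s * max 0 (norm x - d)"
      using \<open>s \<ge> 0\<close> by (intro mult_left_mono) auto
    then show ?thesis
      using tangent_le_square[of s "max 0 (norm x - d)"]
      by (simp add: k_def g_def right_diff_distrib)
  qed
  ultimately show "\<exists>k. convex_on UNIV k \<and> k z = g d z \<and> (\<forall>x\<in>UNIV. k x \<le> g d x)"
    by blast
qed simp

lemma convex_on_huber:
  assumes "0 \<le> R"
  shows "convex_on UNIV (huber R)"
proof (rule convex_on_touching_minorants)
  fix z :: real
  obtain s where s: "\<bar>s\<bar> \<le> R" "huber R z = 2 * s * z - s\<^sup>2"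
    using huber_eq_tangent[OF assms] .
  have "convex_on UNIV (\<lambda>r. 2 * s * r - s\<^sup>2)"
    by (rule convex_onI) (auto simp: algebra_simps)
  then show "\<exists>k. convex_on UNIV k \<and> k z = huber R z \<and> (\<forall>x\<in>UNIV. k x \<le> huber R x)"
    using s tangent_le_huber[OF s(1)] by (intro exI[of _ "\<lambda>r. 2 * s * r - s\<^sup>2"]) simp
qed simp

lemma convex_on_Phi:
  fixes v :: "real ^ 'p"
  assumes "0 \<le> d"
  shows "convex_on UNIV (Phi d v)"
proof (rule convex_onI)
  fix t :: real and x y :: "real ^ 'p" assume t: "0 < t" "t < 1"
  let ?z = "(1 - t) *\<^sub>R x + t *\<^sub>R y"
  let ?a = "\<lambda>u. inner v u / norm v - d"
  have "g d ?z \<le> (1 - t) * g d x + t * g d y"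
    using convex_onD[OF convex_on_g, of t x y] t by simp
  also have "\<dots> \<le> (1 - t) * Phi d v x + t * Phi d v y"
    using t by (intro add_mono mult_left_mono) (auto simp: Phi_def)
  finally have g: "g d ?z \<le> (1 - t) * Phi d v x + t * Phi d v y" .
  \<comment> \<open>The weights sum to 1, so the constant \<open>d\<close> is preserved.\<close>
  have "?a ?z = (1 - t) *\<^sub>R ?a x + t *\<^sub>R ?a y"
    by (simp add: inner_add_right add_divide_distrib algebra_simps diff_divide_distrib)
  then have "huber d (?a ?z) \<le> (1 - t) * huber d (?a x) + t * huber d (?a y)"
    using convex_onD[OF convex_on_huber[OF assms], of t "?a x" "?a y"] t by simp
  also have "\<dots> \<le> (1 - t) * Phi d v x + t * Phi d v y"
    using t by (intro add_mono mult_left_mono) (auto simp: Phi_def)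
  finally show "Phi d v ?z \<le> (1 - t) * Phi d v x + t * Phi d v y"
    using g by (simp add: Phi_def)
qed simp

lemma Phi_tight: "phi d v = Phi d v v"
proof -
  have "inner v v / norm v = norm v"
    by (simp add: dot_square_norm power2_eq_square)
  \<comment> \<open>If \<open>d \<le> norm v\<close>, then \<open>g\<close> equals
    \<open>phi\<close> at \<open>v\<close> and dominates the Huber term. Otherwise \<open>g\<close>
    vanishes and \<open>norm v - d\<close> lies in the quadratic zone.\<close>
  then show ?thesis
    using huber_le_square[of d "norm v - d"] huber_eq_square[of "norm v - d" d]
    by (cases "d \<le> norm v") (auto simp: phi_def Phi_def g_def max_def)
qed

lemma phi_le_Phi: "phi d u \<le> Phi d v u"
proof (cases "d \<le> norm u")
  case True
  then show ?thesis by (simp add: phi_def Phi_def g_def)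
next
  case False
  have "phi d u = huber d (norm u - d)"
    using False by (simp add: phi_def huber_eq_square)
  \<comment> \<open>As \<open>inner v u / norm v \<le> norm u < d\<close>, replacing
    \<open>norm u\<close> by the quotient moves the argument further from 0, starting inside the
    quadratic zone.\<close>
  also have "\<dots> \<le> huber d (inner v u / norm v - d)"
    using False abs_le_D1[OF abs_inner_div_norm_le[of v u]] by (intro huber_mono) auto
  finally show ?thesis by (simp add: Phi_def)
qed

theorem proposition1:
  fixes d :: real and v :: "real ^ 'p"
  assumes "d \<ge> 0" and "v \<noteq> 0"
  shows "convex_on UNIV (Phi d v) \<and>
         phi d v = Phi d v v \<and>
         (\<forall>u. phi d u \<le> Phi d v u)"
  using convex_on_Phi[OF assms(1)] Phi_tight phi_le_Phi by blast

end
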